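(* Let $S_k$ be a finite index set with $p_k=|S_k|\ge2$ and let $x_k=\{X_i\}_{i\in S_k}$ be a real $n\times p_k$ matrix with standardized columns. Let $\hat\rho_{ij}$ be the sample correlations, let $\phi$ be the proportion of variance in $x_k$ explained by the first principal component of $x_k$, and set \[ \rho=\frac{2}{p_k(p_k-1)}\sum_{i>j\in S_k}\hat\rho_{ij},\qquad s^2=\frac{2}{p_k(p_k-1)}\sum_{i>j\in S_k}\hat\rho_{ij}^2,\qquad \rho^i=\frac{1}{p_k-1}\sum_{j\in S_k:\,j\neq i}|\hat\rho_{ij}|\quad(i\in S_k), \] with $s\ge0$ the nonnegative square root of $s^2$. Let $h_{p_k}(t)=\frac1{p_k}+\bigl(1-\frac1{p_k}\bigr)t$, and define $h_\star(t)=\tfrac12(1+\sqrt{2t-1})$ if $t\ge1/2$ and $h_\star(t)=t$ otherwise. Then: (i) $\max\bigl[h_{p_k}(\rho),\,h_\star\{h_{p_k}(s^2)\}\bigr]\le\phi\le\min\bigl\{h_{p_k}(s),\,\max_{i\in S_k}h_{p_k}(\rho^i)\bigr\}$. (ii) If all correlations $\hat\rho_{ij}$ ($i\ne j$ in $S_k$) are equal, then $\phi=h_{p_k}(\rho)$ if $\rho\ge0$, and $\phi=\frac{1-\rho}{p_k}$ otherwise.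
   Context: The columns $X_i\in\mathbb R^n$ are standardized: the entries of $X_i$ sum to $0$ and $\|X_i\|^2=n$ (Euclidean norm). The sample correlation between $X_i$ and $X_j$ is $\hat\rho_{ij}=X_i^\top X_j/(\|X_i\|\,\|X_j\|)$. The principal components of $x_k$ correspond to the eigenvalue decomposition of $x_k^\top x_k$, and the proportion of variance explained by the first principal component is $\phi=\lambda_{\max}(x_k^\top x_k)/\mathrm{tr}(x_k^\top x_k)$, where $\lambda_{\max}$ denotes the largest eigenvalue. *)

theory Defs
  imports "Jordan_Normal_Form.Spectral_Radius"
begin

definition mat_trace :: "'a::comm_monoid_add mat \<Rightarrow> 'a" where
  "mat_trace A = (\<Sum>i<dim_row A. A $$ (i, i))"

definition euclidean_norm :: "real vec \<Rightarrow> real" where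
  "euclidean_norm v = sqrt (v \<bullet> v)"

definition standardized :: "nat \<Rightarrow> real vec \<Rightarrow> bool" where
  "standardized n v \<longleftrightarrow>
     v \<in> carrier_vec n \<and> (\<Sum>a<n. v $ a) = 0 \<and> (euclidean_norm v)\<^sup>2 = real n"

definition sample_corr :: "real vec \<Rightarrow> real vec \<Rightarrow> real" where
  "sample_corr u v = (u \<bullet> v) / (euclidean_norm u * euclidean_norm v)"

(* The columns are listed in increasing order of their index. For infinite S this is the
   n x 0 matrix. *)
definition data_matrix :: "nat \<Rightarrow> ('i::linorder \<Rightarrow> real vec) \<Rightarrow> 'i set \<Rightarrow> real mat" where
  "data_matrix n X S = mat_of_cols n (map X (sorted_list_of_set S))"

(* The spectrum is the set of real eigenvalues. This is intended for real symmetric matrices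
   of positive size, whose spectrum is finite and nonempty; the Max of an empty set is
   unspecified. *)
definition lambda_max :: "real mat \<Rightarrow> real" where
  "lambda_max A = Max (spectrum A)"

definition pc1_proportion :: "real mat \<Rightarrow> real" where
  "pc1_proportion x =
     lambda_max (transpose_mat x * x) / mat_trace (transpose_mat x * x)"

definition mean_corr :: "('i::linorder \<Rightarrow> real vec) \<Rightarrow> 'i set \<Rightarrow> real" where
  "mean_corr X S = 2 / (real (card S) * (real (card S) - 1)) *
     (\<Sum>(i, j) \<in> {(i, j). i \<in> S \<and> j \<in> S \<and> i > j}. sample_corr (X i) (X j))"

definition mean_sq_corr :: "('i::linorder \<Rightarrow> real vec) \<Rightarrow> 'i set \<Rightarrow> real" where
  "mean_sq_corr X S = 2 / (real (card S) * (real (card S) - 1)) *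
     (\<Sum>(i, j) \<in> {(i, j). i \<in> S \<and> j \<in> S \<and> i > j}. (sample_corr (X i) (X j))\<^sup>2)"

definition row_mean_abs_corr :: "('i \<Rightarrow> real vec) \<Rightarrow> 'i set \<Rightarrow> 'i \<Rightarrow> real" where
  "row_mean_abs_corr X S i = 1 / (real (card S) - 1) *
     (\<Sum>j \<in> S - {i}. \<bar>sample_corr (X i) (X j)\<bar>)"

definition h :: "nat \<Rightarrow> real \<Rightarrow> real" where
  "h p t = 1 / real p + (1 - 1 / real p) * t"

definition h_star :: "real \<Rightarrow> real" where
  "h_star t = (if t \<ge> 1 / 2 then (1 + sqrt (2 * t - 1)) / 2 else t)"

end

(* With n R the Gram matrix of the columns, R having unit diagonal, the shares mu_i = lambda_i / (n p)
   of the eigenvalues lambda_i are nonnegative with sum 1, and phi is the largest of them. The trace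
   of the squared Gram matrix gives sum mu_i^2 = h_p(s^2). Both bounds in s follow from this alone:
   the lower one from sum mu_i^2 <= phi and sum mu_i^2 <= phi^2 + (1 - phi)^2, the upper one from
   Cauchy-Schwarz applied to the other p - 1 shares. The Rayleigh quotient of the all-ones vector
   gives h_p(rho) <= phi, and Gershgorin's theorem gives the bound in the rho^i. With equal
   correlations c the only eigenvalues of R are 1 - c and 1 + (p - 1) c. *)

theory Submission
  imports Defs
begin

section \<open>Cauchy-Schwarz and traces of matrix powers\<close>

text \<open>Lagrange's identity: twice the difference of the two sides is the double sum of the
  squares of \<open>a i * b j - a j * b i\<close>.\<close>

lemma Cauchy_Schwarz_sum:
  fixes a b :: "'a \<Rightarrow> real"
  shows "(\<Sum>i\<in>I. a i * b i)\<^sup>2 \<le> (\<Sum>i\<in>I. (a i)\<^sup>2) * (\<Sum>i\<in>I. (b i)\<^sup>2)"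
proof -
  have "0 \<le> (\<Sum>i\<in>I. \<Sum>j\<in>I. (a i * b j - a j * b i)\<^sup>2)"
    by (intro sum_nonneg) auto
  also have "\<dots> = (\<Sum>i\<in>I. \<Sum>j\<in>I. (a i)\<^sup>2 * (b j)\<^sup>2) + (\<Sum>i\<in>I. \<Sum>j\<in>I. (b i)\<^sup>2 * (a j)\<^sup>2)
      - 2 * (\<Sum>i\<in>I. \<Sum>j\<in>I. (a i * b i) * (a j * b j))"
    unfolding sum_distrib_left sum.distrib[symmetric] sum_subtractf[symmetric]
    by (intro sum.cong refl) (simp add: power2_eq_square algebra_simps)
  also have "\<dots> = 2 * ((\<Sum>i\<in>I. (a i)\<^sup>2) * (\<Sum>i\<in>I. (b i)\<^sup>2) - (\<Sum>i\<in>I. a i * b i)\<^sup>2)"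
    unfolding sum_product[symmetric] by (simp add: power2_eq_square)
  finally show ?thesis by simp
qed

lemma mat_trace_mult_comm:
  fixes A B :: "'a::comm_semiring_0 mat"
  assumes "A \<in> carrier_mat n m" "B \<in> carrier_mat m n"
  shows "mat_trace (A * B) = mat_trace (B * A)"
proof -
  have "mat_trace (A * B) = (\<Sum>i<n. \<Sum>j<m. A $$ (i, j) * B $$ (j, i))"
    using assms unfolding mat_trace_def
    by (auto intro!: sum.cong simp: scalar_prod_def lessThan_atLeast0)
  also have "\<dots> = (\<Sum>j<m. \<Sum>i<n. A $$ (i, j) * B $$ (j, i))"
    by (rule sum.swap)
  also have "\<dots> = mat_trace (B * A)"
    using assms unfolding mat_trace_def
    by (auto intro!: sum.cong simp: scalar_prod_def lessThan_atLeast0 mult.commute)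
  finally show ?thesis .
qed

text \<open>Cyclicity of the trace moves \<open>P\<close> in \<open>P * B * Q\<close> to the end,
  where it cancels against \<open>Q\<close>.\<close>

lemma mat_trace_similar:
  fixes A B :: "'a::comm_semiring_1 mat"
  assumes "similar_mat_wit A B P Q"
  shows "mat_trace A = mat_trace B"
proof -
  define n where "n = dim_row A"
  note w = similar_mat_witD[OF n_def assms]
  have "mat_trace A = mat_trace (P * (B * Q))"
    using w assoc_mult_mat[of P n n B n Q n] by simp
  also have "\<dots> = mat_trace (B * Q * P)"
    by (rule mat_trace_mult_comm[of _ n n]) (use w in auto)
  also have "B * Q * P = B * (Q * P)"
    using w assoc_mult_mat[of B n n Q n P n] by simp
  finally show ?thesis using w by simp
qed

text \<open>On or below the diagonal, every summand has \<open>k < i\<close>, which kills the factor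
  from \<open>A\<close>, or \<open>j < k\<close>, which kills the one from \<open>B\<close>, unless
  \<open>k = i = j\<close>.\<close>

lemma upper_triangular_mult_index:
  fixes A B :: "'a::semiring_1 mat"
  assumes "A \<in> carrier_mat n n" "B \<in> carrier_mat n n" "upper_triangular A" "upper_triangular B"
    and "j \<le> i" "i < n"
  shows "(A * B) $$ (i, j) = (if i = j then A $$ (i, i) * B $$ (i, i) else 0)"
proof -
  have "(A * B) $$ (i, j) = (\<Sum>k = 0..<n. A $$ (i, k) * B $$ (k, j))"
    using assms by (simp add: scalar_prod_def)
  also have "\<dots> = (\<Sum>k = 0..<n. if k = i \<and> i = j then A $$ (i, i) * B $$ (i, i) else 0)"
  proof (rule sum.cong)
    fix k assume k: "k \<in> {0..<n}"
    have A0: "A $$ (i, k) = 0" if "k < i"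
      by (rule upper_triangularD[OF assms(3) that]) (use assms in auto)
    have B0: "B $$ (k, j) = 0" if "j < k"
      by (rule upper_triangularD[OF assms(4) that]) (use assms k in auto)
    consider "k < i" | "k > j" | "k = i" "i = j" using assms(5) by linarith
    then show "A $$ (i, k) * B $$ (k, j)
        = (if k = i \<and> i = j then A $$ (i, i) * B $$ (i, i) else 0)"
      by cases (auto simp: A0 B0)
  qed simp
  also have "\<dots> = (if i = j then A $$ (i, i) * B $$ (i, i) else 0)"
    using assms by (cases "i = j") simp_all
  finally show ?thesis .
qed

lemma upper_triangular_pow:
  fixes A :: "'a::semiring_1 mat"
  assumes A: "A \<in> carrier_mat n n" and ut: "upper_triangular A"
  shows "upper_triangular (A ^\<^sub>m k) \<and> (\<forall>i<n. (A ^\<^sub>m k) $$ (i, i) = A $$ (i, i) ^ k)"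
proof (induction k)
  case 0
  then show ?case using A by auto
next
  case (Suc k)
  have "A ^\<^sub>m k \<in> carrier_mat n n" using A by simp
  note * = upper_triangular_mult_index[OF this A _ ut]
  show ?case
    using Suc * A by (auto simp: power_commutes intro!: upper_triangularI)
qed

text \<open>Schur triangularization puts the list \<open>es\<close> on the diagonal of
  \<open>B\<close>. Similarity survives powers, and the diagonal of a power of a triangular matrix
  consists of the powers of its diagonal entries.\<close>

lemma mat_trace_pow_eigenvalues:
  fixes A :: "'a::conjugatable_ordered_field mat"
  assumes A: "A \<in> carrier_mat n n" and es: "char_poly A = (\<Prod>e\<leftarrow>es. [:- e, 1:])"
  shows "mat_trace (A ^\<^sub>m k) = (\<Sum>e\<leftarrow>es. e ^ k)"
proof -
  obtain B P Q where BPQ: "schur_decomposition A es = (B, P, Q)"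
    by (cases "schur_decomposition A es") auto
  from schur_decomposition[OF A es BPQ]
  have sim: "similar_mat_wit A B P Q" and ut: "upper_triangular B" and diag: "diag_mat B = es"
    by auto
  have B: "B \<in> carrier_mat n n" using similar_mat_witD2[OF A sim] by simp
  have "mat_trace (A ^\<^sub>m k) = mat_trace (B ^\<^sub>m k)"
    by (rule mat_trace_similar[OF similar_mat_wit_pow[OF sim]])
  also have "\<dots> = (\<Sum>i<n. B $$ (i, i) ^ k)"
    using upper_triangular_pow[OF B ut, of k] B by (simp add: mat_trace_def)
  also have "\<dots> = (\<Sum>e\<leftarrow>es. e ^ k)"
    using B unfolding diag[symmetric] diag_mat_def
    by (simp add: comp_def interv_sum_list_conv_sum_set_nat lessThan_atLeast0)
  finally show ?thesis .
qed

section \<open>Real spectrum of symmetric matrices\<close>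

text \<open>The Hermitian form \<open>q\<close> of \<open>A\<close> at an eigenvector equals
  \<open>a * N\<close>, where \<open>N\<close> is the squared norm, real and nonzero. Symmetry of
  \<open>A\<close> makes \<open>q\<close> its own conjugate, so \<open>a\<close> is its own
  conjugate too.\<close>

lemma eigenvalue_real_symmetric_in_Reals:
  fixes A :: "real mat"
  assumes A: "A \<in> carrier_mat n n" and sym: "A\<^sup>T = A"
    and ev: "eigenvalue (map_mat complex_of_real A) a"
  shows "a \<in> \<real>"
proof -
  let ?A = "map_mat complex_of_real A"
  obtain v where v: "v \<in> carrier_vec n" "v \<noteq> 0\<^sub>v n" "?A *\<^sub>v v = a \<cdot>\<^sub>v v"
    using ev A unfolding eigenvalue_def eigenvector_def by auto
  have A_sym: "A $$ (i, j) = A $$ (j, i)" if "i < n" "j < n" for i j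
    using that A index_transpose_mat(1)[of j A i] sym by simp
  have row: "(\<Sum>j<n. of_real (A $$ (i, j)) * v $ j) = a * v $ i" if "i < n" for i
  proof -
    have "(\<Sum>j<n. of_real (A $$ (i, j)) * v $ j) = (?A *\<^sub>v v) $ i"
      using that A v(1) by (simp add: scalar_prod_def lessThan_atLeast0)
    also have "\<dots> = a * v $ i" unfolding v(3) using v(1) that by simp
    finally show ?thesis .
  qed
  define N where "N = (\<Sum>i<n. cnj (v $ i) * v $ i)"
  define q where "q = (\<Sum>i<n. \<Sum>j<n. cnj (v $ i) * (of_real (A $$ (i, j)) * v $ j))"
  have q: "q = a * N"
    unfolding q_def N_def sum_distrib_left[symmetric] using row
    by (simp add: sum_distrib_left algebra_simps)
  have N: "N = of_real (\<Sum>i<n. (cmod (v $ i))\<^sup>2)"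
    unfolding N_def of_real_sum complex_norm_square by (intro sum.cong refl mult.commute)
  have "cnj q = (\<Sum>i<n. \<Sum>j<n. v $ i * (of_real (A $$ (i, j)) * cnj (v $ j)))"
    unfolding q_def by simp
  also have "\<dots> = (\<Sum>j<n. \<Sum>i<n. v $ i * (of_real (A $$ (i, j)) * cnj (v $ j)))"
    by (rule sum.swap)
  also have "\<dots> = q"
    unfolding q_def by (intro sum.cong refl) (simp add: A_sym algebra_simps)
  finally have "cnj a * N = a * N" using q N by simp
  moreover have "N \<noteq> 0"
  proof
    assume "N = 0"
    then have "(\<Sum>i<n. (cmod (v $ i))\<^sup>2) = 0" unfolding N of_real_eq_0_iff .
    then have "\<forall>i<n. v $ i = 0" by (subst (asm) sum_nonneg_eq_0_iff) auto
    then show False using v by auto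
  qed
  ultimately show ?thesis by (simp add: Reals_cnj_iff)
qed

text \<open>The characteristic polynomial splits over the complex numbers with real roots;
  injectivity of the embedding of real into complex polynomials brings the factorization
  back.\<close>

lemma char_poly_real_symmetric_splits:
  fixes A :: "real mat"
  assumes A: "A \<in> carrier_mat n n" and sym: "A\<^sup>T = A"
  obtains es where "char_poly A = (\<Prod>e\<leftarrow>es. [:- e, 1:])" "length es = n"
proof -
  let ?A = "map_mat complex_of_real A"
  have cA: "?A \<in> carrier_mat n n" using A by simp
  from char_poly_factorized[OF cA] obtain as
    where as: "char_poly ?A = (\<Prod>a\<leftarrow>as. [:- a, 1:])" "length as = n" by auto
  have real: "a \<in> \<real>" if "a \<in> set as" for a
  proof -
    have "poly (char_poly ?A) a = 0"
      unfolding as poly_prod_list using that by (auto simp: prod_list_zero_iff)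
    then show ?thesis
      using eigenvalue_real_symmetric_in_Reals[OF A sym] eigenvalue_root_char_poly[OF cA] by blast
  qed
  define es where "es = map Re as"
  have as_es: "as = map of_real es"
    unfolding es_def using real by (simp add: map_idI)
  interpret R: map_poly_inj_idom_hom complex_of_real ..
  have "map_poly of_real (char_poly A) = map_poly complex_of_real (\<Prod>e\<leftarrow>es. [:- e, 1:])"
    unfolding of_real_hom.char_poly_hom[OF A, symmetric] as as_es
    by (simp add: R.hom_prod_list comp_def)
  then have "char_poly A = (\<Prod>e\<leftarrow>es. [:- e, 1:])" by (simp only: R.eq_iff)
  moreover have "length es = n" using as by (simp add: es_def)
  ultimately show ?thesis by (rule that)
qed

lemma spectrum_eq_roots:
  fixes A :: "'a::field mat"
  assumes "A \<in> carrier_mat n n" "char_poly A = (\<Prod>e\<leftarrow>es. [:- e, 1:])"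
  shows "spectrum A = set es"
  unfolding spectrum_root_char_poly[OF assms(1)] assms(2) poly_prod_list
  by (auto simp: prod_list_zero_iff)

section \<open>The Rayleigh quotient bound\<close>

lemma Cauchy_Schwarz_scalar_prod:
  fixes u v :: "real vec"
  assumes "dim_vec u = dim_vec v"
  shows "(u \<bullet> v)\<^sup>2 \<le> (u \<bullet> u) * (v \<bullet> v)"
  using Cauchy_Schwarz_sum[of "($) u" "($) v" "{0..<dim_vec v}"] assms
  by (simp add: scalar_prod_def power2_eq_square)

lemma mat_trace_transpose_mult:
  fixes B :: "real mat"
  assumes "B \<in> carrier_mat n m"
  shows "mat_trace (B\<^sup>T * B) = (\<Sum>j<m. \<Sum>i<n. (B $$ (i, j))\<^sup>2)"
  using assms unfolding mat_trace_def
  by (auto intro!: sum.cong simp: scalar_prod_def lessThan_atLeast0 power2_eq_square)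

text \<open>Cauchy-Schwarz row by row; the trace on the right is the squared Frobenius norm of
  \<open>B\<close>.\<close>

lemma mult_mat_vec_Frobenius_bound:
  fixes B :: "real mat"
  assumes B: "B \<in> carrier_mat n m" and v: "v \<in> carrier_vec m"
  shows "(B *\<^sub>v v) \<bullet> (B *\<^sub>v v) \<le> mat_trace (B\<^sup>T * B) * (v \<bullet> v)"
proof -
  have "(B *\<^sub>v v) \<bullet> (B *\<^sub>v v) = (\<Sum>i<n. (row B i \<bullet> v)\<^sup>2)"
    using B by (simp add: scalar_prod_def[of "B *\<^sub>v v"] lessThan_atLeast0 power2_eq_square)
  also have "\<dots> \<le> (\<Sum>i<n. (row B i \<bullet> row B i) * (v \<bullet> v))"
    using B v by (intro sum_mono Cauchy_Schwarz_scalar_prod) auto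
  also have "\<dots> = (\<Sum>i<n. \<Sum>j<m. (B $$ (i, j))\<^sup>2) * (v \<bullet> v)"
    using B unfolding sum_distrib_right[symmetric]
    by (auto intro!: sum.cong arg_cong2[where f = "(*)"]
        simp: scalar_prod_def lessThan_atLeast0 power2_eq_square)
  also have "(\<Sum>i<n. \<Sum>j<m. (B $$ (i, j))\<^sup>2) = mat_trace (B\<^sup>T * B)"
    unfolding mat_trace_transpose_mult[OF B] by (rule sum.swap)
  finally show ?thesis .
qed

lemma pow_mat_add:
  fixes A :: "'a::semiring_1 mat"
  assumes A: "A \<in> carrier_mat n n"
  shows "A ^\<^sub>m (k + l) = A ^\<^sub>m k * A ^\<^sub>m l"
proof (induction l)
  case 0
  have "A ^\<^sub>m k \<in> carrier_mat n n" using A by simp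
  then show ?case using A by simp
next
  case (Suc l)
  have "A ^\<^sub>m k \<in> carrier_mat n n" "A ^\<^sub>m l \<in> carrier_mat n n" using A by simp_all
  then show ?case using A Suc assoc_mult_mat[of "A ^\<^sub>m k" n n "A ^\<^sub>m l" n A n] by simp
qed

lemma transpose_pow_mat:
  fixes A :: "'a::comm_semiring_1 mat"
  assumes A: "A \<in> carrier_mat n n" and sym: "A\<^sup>T = A"
  shows "(A ^\<^sub>m k)\<^sup>T = A ^\<^sub>m k"
proof (induction k)
  case 0
  then show ?case by simp
next
  case (Suc k)
  have k: "A ^\<^sub>m k \<in> carrier_mat n n" using A by simp
  have "(A ^\<^sub>m Suc k)\<^sup>T = A * A ^\<^sub>m k"
    using transpose_mult[OF k A] sym Suc by simp
  also have "\<dots> = A ^\<^sub>m (1 + k)"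
    using A pow_mat_add[OF A, of 1 k] by simp
  finally show ?case by simp
qed

(* Power method: for r k = v . A^k v / v . v, Cauchy-Schwarz gives r k ^ 2 <= r (2 k), while
   r (2 k) is at most the squared Frobenius norm of A^k, that is, the sum of the e^(2 k). *)
lemma Rayleigh_quotient_le:
  fixes A :: "real mat"
  assumes A: "A \<in> carrier_mat n n" and sym: "A\<^sup>T = A"
    and es: "char_poly A = (\<Prod>e\<leftarrow>es. [:- e, 1:])"
    and L: "\<And>e. e \<in> set es \<Longrightarrow> \<bar>e\<bar> \<le> L" "0 \<le> L"
    and v: "v \<in> carrier_vec n"
  shows "v \<bullet> (A *\<^sub>v v) \<le> L * (v \<bullet> v)"
proof (cases "v \<bullet> v = 0")
  case True
  then have "(v \<bullet> (A *\<^sub>v v))\<^sup>2 \<le> 0"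
    using Cauchy_Schwarz_scalar_prod[of v "A *\<^sub>v v"] A v by simp
  then show ?thesis using True by simp
next
  case False
  define q where "q = v \<bullet> v"
  have "q \<ge> 0" unfolding q_def scalar_prod_def by (intro sum_nonneg) simp
  then have q: "q > 0" using False q_def by simp
  define r where "r k = v \<bullet> (A ^\<^sub>m k *\<^sub>v v) / q" for k
  have even: "v \<bullet> (A ^\<^sub>m (k + k) *\<^sub>v v) = (A ^\<^sub>m k *\<^sub>v v) \<bullet> (A ^\<^sub>m k *\<^sub>v v)" for k
  proof -
    have k: "A ^\<^sub>m k \<in> carrier_mat n n" using A by simp
    have "(A ^\<^sub>m k *\<^sub>v v) \<bullet> (A ^\<^sub>m k *\<^sub>v v) = v \<bullet> (A ^\<^sub>m k *\<^sub>v (A ^\<^sub>m k *\<^sub>v v))"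
      using transpose_vec_mult_scalar[OF k _ v, of "A ^\<^sub>m k *\<^sub>v v"]
        transpose_vec_mult_scalar[OF k, of "A ^\<^sub>m k *\<^sub>v v" v] transpose_pow_mat[OF A sym] k v
      by simp
    then show ?thesis
      using pow_mat_add[OF A, of k k] assoc_mult_mat_vec[OF k k v] by simp
  qed
  have sq: "(r k)\<^sup>2 \<le> r (k + k)" for k
  proof -
    have "(v \<bullet> (A ^\<^sub>m k *\<^sub>v v))\<^sup>2 \<le> q * (v \<bullet> (A ^\<^sub>m (k + k) *\<^sub>v v))"
      unfolding q_def even by (rule Cauchy_Schwarz_scalar_prod) (use A v in simp)
    then show ?thesis using q unfolding r_def by (simp add: field_simps power2_eq_square)
  qed
  have bound: "r (k + k) \<le> real (length es) * L ^ (k + k)" for k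
  proof -
    have k: "A ^\<^sub>m k \<in> carrier_mat n n" using A by simp
    have "v \<bullet> (A ^\<^sub>m (k + k) *\<^sub>v v) \<le> mat_trace (A ^\<^sub>m (k + k)) * q"
      using mult_mat_vec_Frobenius_bound[OF k v] unfolding even q_def
      by (simp add: transpose_pow_mat[OF A sym] pow_mat_add[OF A, symmetric])
    then have "r (k + k) \<le> mat_trace (A ^\<^sub>m (k + k))"
      using q unfolding r_def by (simp add: field_simps)
    also have "\<dots> = (\<Sum>e\<leftarrow>es. e ^ (k + k))"
      by (rule mat_trace_pow_eigenvalues[OF A es])
    also have "\<dots> \<le> (\<Sum>e\<leftarrow>es. L ^ (k + k))"
    proof (rule sum_list_mono)
      fix e assume "e \<in> set es"
      then have "\<bar>e\<bar> ^ (k + k) \<le> L ^ (k + k)" using L(1) by (intro power_mono) auto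
      then show "e ^ (k + k) \<le> L ^ (k + k)" by (simp add: power_even_abs)
    qed
    finally show ?thesis by (simp add: sum_list_triv)
  qed
  \<comment> \<open>Repeated use of \<open>sq\<close>; positivity of \<open>r 1\<close> is what
    allows the induction hypothesis to be squared.\<close>
  have iter: "r 1 ^ (2 ^ k) \<le> r (2 ^ k)" if "r 1 > 0" for k
  proof (induction k)
    case (Suc k)
    have "r 1 ^ (2 ^ Suc k) = (r 1 ^ (2 ^ k))\<^sup>2"
      by (simp add: power_mult[symmetric] mult.commute)
    also have "\<dots> \<le> (r (2 ^ k))\<^sup>2" using Suc that by (intro power_mono) auto
    also have "\<dots> \<le> r (2 ^ Suc k)" using sq[of "2 ^ k"] by (simp add: mult_2)
    finally show ?case .
  qed simp
  have "r 1 \<le> L"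
  proof (rule ccontr)
    assume "\<not> r 1 \<le> L"
    then have gt: "L < r 1" by simp
    then have pos: "r 1 > 0" using L(2) by linarith
    \<comment> \<open>The exponent starts at 2 because \<open>bound\<close> covers only even powers.
      For \<open>L > 0\<close> this keeps arbitrarily high powers of \<open>r 1 / L\<close> below
      the constant \<open>length es\<close>, which is impossible for a ratio above 1.\<close>
    have *: "r 1 ^ (2 ^ Suc k) \<le> real (length es) * L ^ (2 ^ Suc k)" for k
      using iter[OF pos, of "Suc k"] bound[of "2 ^ k"] by (simp add: mult_2)
    show False
    proof (cases "L = 0")
      case True
      then show False using *[of 0] pos by simp
    next
      case False
      then have "r 1 / L > 1" using gt L(2) by simp
      then obtain j where j: "real (length es) < (r 1 / L) ^ j"
        using real_arch_pow by blast
      have "j \<le> 2 ^ Suc j" using less_exp[of "Suc j"] by linarith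
      then have "(r 1 / L) ^ j \<le> (r 1 / L) ^ (2 ^ Suc j)"
        using \<open>r 1 / L > 1\<close> by (intro power_increasing) auto
      also have "\<dots> \<le> real (length es)"
        using *[of j] False L(2) by (simp add: power_divide divide_le_eq del: power_Suc)
      finally show False using j by simp
    qed
  qed
  then show ?thesis using q A v unfolding r_def q_def by (simp add: field_simps)
qed

section \<open>Locating eigenvalues: Gershgorin, Gram matrices, equal correlations\<close>

lemma nonzero_vec_entry:
  assumes "v \<in> carrier_vec n" "v \<noteq> 0\<^sub>v n"
  obtains i where "i < n" "v $ i \<noteq> 0"
proof -
  have "\<not> (\<forall>i<n. v $ i = 0)" using assms by auto
  then show ?thesis using that by blast
qed

text \<open>Take a row \<open>i\<close> where the eigenvector has its largest absolute entry. The
  eigenvalue equation in that row bounds \<open>\<bar>k - A $$ (i, i)\<bar>\<close> after division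
  by this positive entry.\<close>

lemma Gershgorin_upper_bound:
  fixes A :: "real mat"
  assumes A: "A \<in> carrier_mat n n" and ev: "eigenvalue A k"
  obtains i where "i < n" "k \<le> A $$ (i, i) + (\<Sum>j\<in>{..<n} - {i}. \<bar>A $$ (i, j)\<bar>)"
proof -
  obtain v where v: "v \<in> carrier_vec n" "v \<noteq> 0\<^sub>v n" "A *\<^sub>v v = k \<cdot>\<^sub>v v"
    using ev A unfolding eigenvalue_def eigenvector_def by auto
  obtain l where l: "l < n" "v $ l \<noteq> 0" using v(1,2) by (rule nonzero_vec_entry)
  have fin: "finite ((\<lambda>i. \<bar>v $ i\<bar>) ` {..<n})" "(\<lambda>i. \<bar>v $ i\<bar>) ` {..<n} \<noteq> {}" using l by auto
  obtain i where i: "i < n" "\<bar>v $ i\<bar> = Max ((\<lambda>i. \<bar>v $ i\<bar>) ` {..<n})"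
    using Max_in[OF fin] by auto
  have max: "\<bar>v $ j\<bar> \<le> \<bar>v $ i\<bar>" if "j < n" for j
    unfolding i using fin that by (intro Max_ge) auto
  have pos: "\<bar>v $ i\<bar> > 0" using max[OF l(1)] l(2) by linarith
  have "(\<Sum>j<n. A $$ (i, j) * v $ j) = (A *\<^sub>v v) $ i"
    using i(1) A v(1) by (simp add: scalar_prod_def lessThan_atLeast0)
  also have "\<dots> = k * v $ i" unfolding v(3) using v(1) i(1) by simp
  finally have "k * v $ i = A $$ (i, i) * v $ i + (\<Sum>j\<in>{..<n} - {i}. A $$ (i, j) * v $ j)"
    using i(1) sum.remove[of "{..<n}" i "\<lambda>j. A $$ (i, j) * v $ j"] by simp
  then have "(k - A $$ (i, i)) * v $ i = (\<Sum>j\<in>{..<n} - {i}. A $$ (i, j) * v $ j)"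
    by (simp add: algebra_simps)
  then have "\<bar>k - A $$ (i, i)\<bar> * \<bar>v $ i\<bar> = \<bar>\<Sum>j\<in>{..<n} - {i}. A $$ (i, j) * v $ j\<bar>"
    by (simp add: abs_mult[symmetric])
  also have "\<dots> \<le> (\<Sum>j\<in>{..<n} - {i}. \<bar>A $$ (i, j)\<bar> * \<bar>v $ i\<bar>)"
    by (rule order_trans[OF sum_abs], intro sum_mono)
      (auto simp: abs_mult intro!: mult_left_mono max)
  finally have "\<bar>k - A $$ (i, i)\<bar> \<le> (\<Sum>j\<in>{..<n} - {i}. \<bar>A $$ (i, j)\<bar>)"
    unfolding sum_distrib_right[symmetric] using pos by simp
  then show ?thesis using i(1) by (intro that) auto
qed

text \<open>For an eigenvector \<open>v\<close>, the number \<open>k * (v \<bullet> v)\<close> is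
  the squared norm of \<open>x *\<^sub>v v\<close>.\<close>

lemma eigenvalue_transpose_mult_nonneg:
  fixes x :: "real mat"
  assumes x: "x \<in> carrier_mat n m" and ev: "eigenvalue (x\<^sup>T * x) k"
  shows "k \<ge> 0"
proof -
  obtain v where v: "v \<in> carrier_vec m" "v \<noteq> 0\<^sub>v m" "(x\<^sup>T * x) *\<^sub>v v = k \<cdot>\<^sub>v v"
    using ev x unfolding eigenvalue_def eigenvector_def by auto
  have "k * (v \<bullet> v) = ((x\<^sup>T * x) *\<^sub>v v) \<bullet> v"
    unfolding v(3) using v(1) by simp
  also have "(x\<^sup>T * x) *\<^sub>v v = x\<^sup>T *\<^sub>v (x *\<^sub>v v)"
    by (rule assoc_mult_mat_vec) (use x v in auto)
  also have "\<dots> \<bullet> v = (x *\<^sub>v v) \<bullet> (x *\<^sub>v v)"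
    by (rule transpose_vec_mult_scalar[OF x v(1) mult_mat_vec_carrier[OF x v(1)]])
  also have "\<dots> \<ge> 0" unfolding scalar_prod_def by (intro sum_nonneg) simp
  finally have "k * (v \<bullet> v) \<ge> 0" .
  moreover have "v \<bullet> v > 0"
    using conjugate_square_greater_0_vec[OF v(1)] v(2) by simp
  ultimately show ?thesis by (simp add: zero_le_mult_iff)
qed

text \<open>With \<open>t\<close> the sum of the entries of an eigenvector, each row of the
  eigenvalue equation reads \<open>k * v $ i = (d - c) * v $ i + c * t\<close>. If
  \<open>t = 0\<close>, a nonzero entry gives the first value; otherwise summing the rows and
  cancelling \<open>t\<close> gives the second.\<close>

lemma eigenvalue_equicorrelation_cases:
  fixes A :: "real mat"
  assumes A: "A \<in> carrier_mat n n"
    and entries: "\<And>i j. i < n \<Longrightarrow> j < n \<Longrightarrow> A $$ (i, j) = (if i = j then d else c)"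
    and ev: "eigenvalue A k"
  shows "k = d - c \<or> k = d + (real n - 1) * c"
proof -
  obtain v where v: "v \<in> carrier_vec n" "v \<noteq> 0\<^sub>v n" "A *\<^sub>v v = k \<cdot>\<^sub>v v"
    using ev A unfolding eigenvalue_def eigenvector_def by auto
  define t where "t = (\<Sum>j<n. v $ j)"
  have row: "k * v $ i = (d - c) * v $ i + c * t" if "i < n" for i
  proof -
    have "k * v $ i = (A *\<^sub>v v) $ i" unfolding v(3) using v(1) that by simp
    also have "\<dots> = (\<Sum>j<n. A $$ (i, j) * v $ j)"
      using that A v(1) by (simp add: scalar_prod_def lessThan_atLeast0)
    also have "\<dots> = (\<Sum>j<n. (if j = i then (d - c) * v $ i else 0) + c * v $ j)"
      using that by (intro sum.cong) (auto simp: entries algebra_simps)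
    also have "\<dots> = (d - c) * v $ i + c * t"
      using that by (simp add: sum.distrib t_def sum_distrib_left)
    finally show ?thesis .
  qed
  show ?thesis
  proof (cases "t = 0")
    case True
    obtain l where l: "l < n" "v $ l \<noteq> 0" using v(1,2) by (rule nonzero_vec_entry)
    then show ?thesis using row[OF l(1)] True by simp
  next
    case False
    have "k * t = (\<Sum>i<n. k * v $ i)" by (simp add: t_def sum_distrib_left)
    also have "\<dots> = (\<Sum>i<n. (d - c) * v $ i + c * t)" by (intro sum.cong) (simp_all add: row)
    also have "\<dots> = (d - c) * t + real n * (c * t)"
      by (simp add: sum.distrib t_def sum_distrib_left)
    finally have "t * (k - (d + (real n - 1) * c)) = 0" by (simp add: algebra_simps)
    then show ?thesis using False by simp
  qed
qed

text \<open>The difference of two unit vectors is orthogonal to the all-ones vector, so the constant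
  part \<open>c\<close> of the matrix annihilates it.\<close>

lemma eigenvalue_equicorrelation:
  fixes A :: "real mat"
  assumes A: "A \<in> carrier_mat n n" and n: "n \<ge> 2"
    and entries: "\<And>i j. i < n \<Longrightarrow> j < n \<Longrightarrow> A $$ (i, j) = (if i = j then d else c)"
  shows "eigenvalue A (d - c)"
proof -
  define v :: "real vec" where "v = unit_vec n 0 - unit_vec n 1"
  have v: "v \<in> carrier_vec n" unfolding v_def by simp
  have "v $ 0 = 1" unfolding v_def using n by simp
  then have "v \<noteq> 0\<^sub>v n" using n by auto
  moreover have "A *\<^sub>v v = (d - c) \<cdot>\<^sub>v v"
  proof (rule eq_vecI)
    fix i assume "i < dim_vec ((d - c) \<cdot>\<^sub>v v)"
    then have i: "i < n" using v by simp
    have "(A *\<^sub>v v) $ i = row A i \<bullet> unit_vec n 0 - row A i \<bullet> unit_vec n 1"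
      using i A n unfolding v_def by (simp add: scalar_prod_minus_distrib[of _ n])
    also have "\<dots> = A $$ (i, 0) - A $$ (i, 1)" using i A n by simp
    also have "\<dots> = ((d - c) \<cdot>\<^sub>v v) $ i"
      using i n unfolding v_def by (auto simp: entries)
    finally show "(A *\<^sub>v v) $ i = ((d - c) \<cdot>\<^sub>v v) $ i" .
  qed (use A v in simp)
  ultimately show ?thesis
    using A v unfolding eigenvalue_def eigenvector_def by auto
qed

section \<open>Inequalities for nonnegative shares and for shares with given sum of squares\<close>

text \<open>For \<open>t \<ge> 1 / 2\<close>, \<open>h_star t\<close> is the larger root
  \<open>M\<close> of \<open>M\<^sup>2 + (1 - M)\<^sup>2 = t\<close>. This quadratic bounds the sum
  of squares because each remaining share is at most \<open>1 - \<mu> m\<close>, the total of the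
  rest.\<close>

lemma h_star_le_largest_share:
  fixes \<mu> :: "'a \<Rightarrow> real"
  assumes I: "finite I" "m \<in> I"
    and nonneg: "\<And>i. i \<in> I \<Longrightarrow> 0 \<le> \<mu> i" and max: "\<And>i. i \<in> I \<Longrightarrow> \<mu> i \<le> \<mu> m"
    and sum1: "(\<Sum>i\<in>I. \<mu> i) = 1"
  shows "h_star (\<Sum>i\<in>I. (\<mu> i)\<^sup>2) \<le> \<mu> m"
proof -
  let ?t = "\<Sum>i\<in>I. (\<mu> i)\<^sup>2" and ?J = "I - {m}"
  have "?t \<le> (\<Sum>i\<in>I. \<mu> m * \<mu> i)"
    unfolding power2_eq_square by (intro sum_mono mult_right_mono max nonneg)
  then have t_le: "?t \<le> \<mu> m" unfolding sum_distrib_left[symmetric] sum1 by simp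
  have rest: "(\<Sum>i\<in>?J. \<mu> i) = 1 - \<mu> m"
    using sum1 sum.remove[OF I(1,2), of \<mu>] by simp
  have "(\<Sum>i\<in>?J. (\<mu> i)\<^sup>2) \<le> (\<Sum>i\<in>?J. (1 - \<mu> m) * \<mu> i)"
    unfolding power2_eq_square
  proof (intro sum_mono mult_right_mono)
    fix i assume i: "i \<in> ?J"
    have "\<mu> i \<le> (\<Sum>i\<in>?J. \<mu> i)"
      using I i by (intro member_le_sum) (auto intro: nonneg)
    then show "\<mu> i \<le> 1 - \<mu> m" unfolding rest .
  qed (auto intro: nonneg)
  then have "(\<Sum>i\<in>?J. (\<mu> i)\<^sup>2) \<le> (1 - \<mu> m)\<^sup>2"
    unfolding sum_distrib_left[symmetric] rest by (simp add: power2_eq_square)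
  then have "?t \<le> (\<mu> m)\<^sup>2 + (1 - \<mu> m)\<^sup>2"
    using sum.remove[OF I, of "\<lambda>i. (\<mu> i)\<^sup>2"] by simp
  then have "2 * ?t - 1 \<le> (2 * \<mu> m - 1)\<^sup>2"
    by (simp add: power2_eq_square algebra_simps)
  then have "sqrt (2 * ?t - 1) \<le> \<bar>2 * \<mu> m - 1\<bar>"
    using real_sqrt_le_mono[of "2 * ?t - 1" "(2 * \<mu> m - 1)\<^sup>2"] by simp
  then show ?thesis using t_le unfolding h_star_def by auto
qed

text \<open>Cauchy-Schwarz of the other \<open>p - 1\<close> shares against the constant 1 bounds
  \<open>(1 - \<mu> m)\<^sup>2\<close> by \<open>p - 1\<close> times their sum of squares.\<close>

lemma share_le_h:
  fixes \<mu> :: "'a \<Rightarrow> real"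
  assumes I: "finite I" "m \<in> I" "card I = p" "p \<ge> 2"
    and sum1: "(\<Sum>i\<in>I. \<mu> i) = 1"
    and s: "s \<ge> 0" "(\<Sum>i\<in>I. (\<mu> i)\<^sup>2) = h p (s\<^sup>2)"
  shows "\<mu> m \<le> h p s"
proof -
  let ?J = "I - {m}" and ?M = "\<mu> m"
  have "(\<Sum>i\<in>?J. \<mu> i) = 1 - ?M"
    using sum1 sum.remove[OF I(1,2), of \<mu>] by simp
  moreover have "(\<Sum>i\<in>?J. (\<mu> i)\<^sup>2) = h p (s\<^sup>2) - ?M\<^sup>2"
    using s(2) sum.remove[OF I(1,2), of "\<lambda>i. (\<mu> i)\<^sup>2"] by simp
  moreover have "real (card ?J) = real p - 1" using I by (simp add: of_nat_diff)
  ultimately have "(1 - ?M)\<^sup>2 \<le> (h p (s\<^sup>2) - ?M\<^sup>2) * (real p - 1)"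
    using Cauchy_Schwarz_sum[of \<mu> "\<lambda>_. 1" ?J] by simp
  \<comment> \<open>The factor \<open>p\<close> clears the denominator in \<open>h\<close> and
    completes the square in \<open>?M\<close>, leaving \<open>(p * ?M - 1)\<^sup>2\<close> on the
    left.\<close>
  then have "real p * (1 - ?M)\<^sup>2 \<le> real p * ((h p (s\<^sup>2) - ?M\<^sup>2) * (real p - 1))"
    using I by (intro mult_left_mono) auto
  also have "\<dots> = (1 + (real p - 1) * s\<^sup>2 - real p * ?M\<^sup>2) * (real p - 1)"
    using I by (simp add: h_def field_simps)
  finally have "(real p * ?M - 1)\<^sup>2 \<le> ((real p - 1) * s)\<^sup>2"
    by (simp add: power2_eq_square algebra_simps)
  then have "real p * ?M - 1 \<le> (real p - 1) * s"
    by (rule power2_le_imp_le) (use s(1) I in simp)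
  then show ?thesis using I by (simp add: h_def field_simps)
qed

section \<open>From the data matrix to correlations\<close>

text \<open>The means in the theorem run over pairs \<open>i > j\<close>, whereas traces and
  quadratic forms produce full double sums. Swapping coordinates matches the two open
  triangles.\<close>

lemma sum_symmetric_off_diagonal:
  fixes f :: "'i::linorder \<Rightarrow> 'i \<Rightarrow> real"
  assumes S: "finite S" and sym: "\<And>i j. i \<in> S \<Longrightarrow> j \<in> S \<Longrightarrow> f i j = f j i"
  shows "(\<Sum>i\<in>S. \<Sum>j\<in>S. f i j)
    = (\<Sum>i\<in>S. f i i) + 2 * (\<Sum>(i, j)\<in>{(i, j). i \<in> S \<and> j \<in> S \<and> i > j}. f i j)"
proof -
  let ?U = "{(i, j). i \<in> S \<and> j \<in> S \<and> i > j}" and ?L = "{(i, j). i \<in> S \<and> j \<in> S \<and> j > i}"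
  let ?D = "(\<lambda>i. (i, i)) ` S"
  have sub: "?U \<subseteq> S \<times> S" "?L \<subseteq> S \<times> S" "?D \<subseteq> S \<times> S" by auto
  then have fin: "finite ?U" "finite ?L" "finite ?D" using S finite_subset by blast+
  have split: "S \<times> S = ?D \<union> (?U \<union> ?L)" by auto
  have swap: "(\<Sum>(i, j)\<in>?L. f i j) = (\<Sum>(i, j)\<in>?U. f i j)"
    by (rule sum.reindex_bij_witness[of _ prod.swap prod.swap]) (auto simp: sym)
  have "(\<Sum>i\<in>S. \<Sum>j\<in>S. f i j) = (\<Sum>(i, j)\<in>S \<times> S. f i j)"
    by (rule sum.cartesian_product)
  also have "\<dots> = (\<Sum>(i, j)\<in>?D. f i j) + ((\<Sum>(i, j)\<in>?U. f i j) + (\<Sum>(i, j)\<in>?L. f i j))"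
  proof -
    have "?U \<inter> ?L = {}" "?D \<inter> (?U \<union> ?L) = {}" by auto
    then show ?thesis
      unfolding split using fin by (simp add: sum.union_disjoint)
  qed
  also have "(\<Sum>(i, j)\<in>?D. f i j) = (\<Sum>i\<in>S. f i i)"
    by (subst sum.reindex) (auto simp: inj_on_def)
  finally show ?thesis unfolding swap by simp
qed

text \<open>Since \<open>lambda_max\<close> is a \<open>Max\<close>, it is an eigenvalue and an
  upper bound only once the spectrum is known to be finite and nonempty; the splitting and
  \<open>p \<ge> 1\<close> provide this. The list \<open>es\<close> retains multiplicities, which
  the spectrum loses.\<close>

lemma spectrum_Gram_matrix:
  fixes x :: "real mat"
  assumes x: "x \<in> carrier_mat n p" and p: "p \<ge> 1"
  defines "G \<equiv> x\<^sup>T * x"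
  obtains es where "length es = p" "\<And>e. e \<in> set es \<Longrightarrow> 0 \<le> e" "spectrum G = set es"
    "char_poly G = (\<Prod>e\<leftarrow>es. [:- e, 1:])"
    "lambda_max G \<in> set es" "\<And>e. e \<in> set es \<Longrightarrow> e \<le> lambda_max G"
proof -
  have G: "G \<in> carrier_mat p p" unfolding G_def using x by simp
  have sym: "G\<^sup>T = G" unfolding G_def using x by (simp add: transpose_mult[of _ p n _ p])
  obtain es where es: "char_poly G = (\<Prod>e\<leftarrow>es. [:- e, 1:])" "length es = p"
    by (rule char_poly_real_symmetric_splits[OF G sym])
  have spec: "spectrum G = set es" by (rule spectrum_eq_roots[OF G es(1)])
  have "0 \<le> e" if "e \<in> set es" for e
    using eigenvalue_transpose_mult_nonneg[OF x, folded G_def] that spec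
    unfolding spectrum_def by auto
  moreover have "set es \<noteq> {}" using es(2) p by auto
  then have "lambda_max G \<in> set es" "\<And>e. e \<in> set es \<Longrightarrow> e \<le> lambda_max G"
    unfolding lambda_max_def spec by auto
  ultimately show ?thesis using that es spec by blast
qed

text \<open>Matrix positions are numbers while correlations are indexed by \<open>S\<close>; the
  sorted list \<open>l\<close> translates between them.\<close>

lemma index_data_matrix_Gram:
  fixes X :: "'i::linorder \<Rightarrow> real vec"
  assumes S: "finite S" and X: "\<And>i. i \<in> S \<Longrightarrow> X i \<in> carrier_vec n"
    and a: "a < card S" and b: "b < card S"
  defines "l \<equiv> sorted_list_of_set S"
  shows "((data_matrix n X S)\<^sup>T * data_matrix n X S) $$ (a, b) = X (l ! a) \<bullet> X (l ! b)"
proof -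
  have len: "length l = card S" and set: "set l = S" using S by (simp_all add: l_def)
  have "l ! a \<in> S" "l ! b \<in> S" using a b len set nth_mem by metis+
  then have "col (data_matrix n X S) a = X (l ! a)" "col (data_matrix n X S) b = X (l ! b)"
    unfolding data_matrix_def l_def[symmetric]
    using a b len X by (auto simp: col_mat_of_cols)
  moreover have "dim_col (data_matrix n X S) = card S"
    unfolding data_matrix_def l_def[symmetric] using len by simp
  ultimately show ?thesis using a b by simp
qed

text \<open>Both norms are the square root of \<open>n\<close>, so the Gram matrix is
  \<open>n\<close> times the correlation matrix.\<close>

lemma sample_corr_standardized:
  assumes "n \<ge> 1" "standardized n u" "standardized n v"
  shows "u \<bullet> v = real n * sample_corr u v"
proof -
  have "(euclidean_norm u)\<^sup>2 = real n" "(euclidean_norm v)\<^sup>2 = real n"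
    using assms unfolding standardized_def by auto
  moreover have "0 \<le> w \<bullet> w" for w :: "real vec"
    unfolding scalar_prod_def by (intro sum_nonneg) simp
  then have "0 \<le> euclidean_norm u" "0 \<le> euclidean_norm v"
    unfolding euclidean_norm_def by simp_all
  ultimately have "euclidean_norm u = sqrt (real n)" "euclidean_norm v = sqrt (real n)"
    by (metis real_sqrt_unique)+
  then show ?thesis using assms(1) unfolding sample_corr_def by simp
qed

text \<open>With \<open>n \<ge> 1\<close> the denominator is nonzero; for \<open>n = 0\<close> the
  quotient would be 0 by the convention on division by zero.\<close>

lemma sample_corr_self:
  assumes "n \<ge> 1" "standardized n u"
  shows "sample_corr u u = 1"
proof -
  have "u \<bullet> u \<ge> 0" unfolding scalar_prod_def by (intro sum_nonneg) simp
  then have "u \<bullet> u = real n"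
    using assms(2) unfolding standardized_def euclidean_norm_def by simp
  then show ?thesis using sample_corr_standardized[OF assms(1,2,2)] assms(1) by simp
qed

lemma sample_corr_commute:
  assumes "dim_vec u = dim_vec v"
  shows "sample_corr u v = sample_corr v u"
proof -
  have "u \<bullet> v = v \<bullet> u"
    using assms by (intro comm_scalar_prod[of _ "dim_vec v"]) (auto intro: carrier_vecI)
  then show ?thesis unfolding sample_corr_def by (metis mult.commute)
qed

section \<open>Bounds for the leading share and its value under equal correlations\<close>

theorem proposition4:
  fixes n :: nat and S :: "'i::linorder set" and X :: "'i \<Rightarrow> real vec"
    and p :: nat and \<phi> \<rho> s :: real
  assumes "n \<ge> 1"
    and "finite S"
    and "p = card S"
    and "p \<ge> 2"
    and "\<And>i. i \<in> S \<Longrightarrow> standardized n (X i)"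
    and "\<phi> = pc1_proportion (data_matrix n X S)"
    and "\<rho> = mean_corr X S"
    and "s \<ge> 0"
    and "s\<^sup>2 = mean_sq_corr X S"
  shows "(max (h p \<rho>) (h_star (h p (s\<^sup>2))) \<le> \<phi> \<and>
          \<phi> \<le> min (h p s) (Max ((\<lambda>i. h p (row_mean_abs_corr X S i)) ` S))) \<and>
         ((\<exists>c. \<forall>i\<in>S. \<forall>j\<in>S. i \<noteq> j \<longrightarrow> sample_corr (X i) (X j) = c) \<longrightarrow>
           \<phi> = (if \<rho> \<ge> 0 then h p \<rho> else (1 - \<rho>) / real p))"
proof -
  note n = assms(1) and S = assms(2) and p = assms(3,4) and std = assms(5)
  define r where "r i j = sample_corr (X i) (X j)" for i j
  define x where "x = data_matrix n X S"
  define G where "G = x\<^sup>T * x"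
  define l where "l = sorted_list_of_set S"
  have l: "bij_betw ((!) l) {..<p} S"
    unfolding l_def using S p(1) by (intro bij_betw_nth) auto
  have lS: "l ! a \<in> S" if "a < p" for a using bij_betwE[OF l] that by simp
  have X: "X i \<in> carrier_vec n" if "i \<in> S" for i using std[OF that] unfolding standardized_def by simp
  have r1: "r i i = 1" if "i \<in> S" for i unfolding r_def by (rule sample_corr_self[OF n std[OF that]])
  have rsym: "r i j = r j i" if "i \<in> S" "j \<in> S" for i j
    unfolding r_def using X[OF that(1)] X[OF that(2)] by (intro sample_corr_commute) simp
  have x: "x \<in> carrier_mat n p"
    unfolding x_def data_matrix_def using S p(1) by auto
  have G: "G \<in> carrier_mat p p" unfolding G_def using x by simp
  have sym: "G\<^sup>T = G" unfolding G_def using x by (simp add: transpose_mult[of _ p n _ p])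
  have entry: "G $$ (a, b) = real n * r (l ! a) (l ! b)" if "a < p" "b < p" for a b
    using index_data_matrix_Gram[OF S X, where a = a and b = b] that p(1) lS
      sample_corr_standardized[OF n std std, of "l ! a" "l ! b"]
    unfolding G_def x_def l_def r_def by simp
  have np: "real n > 0" "real p > 0" "real p - 1 > 0" using n p by auto
  have reindex: "(\<Sum>a<p. \<Sum>b<p. f (l ! a) (l ! b)) = (\<Sum>i\<in>S. \<Sum>j\<in>S. f i j)"
    for f :: "'i \<Rightarrow> 'i \<Rightarrow> real"
    using sum.reindex_bij_betw[OF l, of "\<lambda>i. \<Sum>j\<in>S. f i j"] sum.reindex_bij_betw[OF l]
    by (metis (no_types, lifting) sum.cong)
  have cS: "card S = p" using p by simp
  \<comment> \<open>This is where \<open>h\<close> comes from: the diagonal contributes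
    \<open>p\<close>, the pairs \<open>i > j\<close> count twice, and \<open>h p\<close> of their
    mean is the average over all entries. It serves for the correlations and for their
    squares.\<close>
  have h_mean: "real p + 2 * t = (real p)\<^sup>2 * h p (2 / (real p * (real p - 1)) * t)" for t
    using np unfolding h_def by (simp add: field_simps power2_eq_square)
  have sum_r: "(\<Sum>i\<in>S. \<Sum>j\<in>S. r i j) = (real p)\<^sup>2 * h p \<rho>"
    using sum_symmetric_off_diagonal[of S r, OF S rsym]
    unfolding assms(7) mean_corr_def r_def[symmetric] cS h_mean[symmetric] by (simp add: r1 cS)
  have sum_r2: "(\<Sum>i\<in>S. \<Sum>j\<in>S. (r i j)\<^sup>2) = (real p)\<^sup>2 * h p (s\<^sup>2)"
    using sum_symmetric_off_diagonal[of S "\<lambda>i j. (r i j)\<^sup>2", OF S] rsym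
    unfolding assms(9) mean_sq_corr_def r_def[symmetric] cS h_mean[symmetric] by (simp add: r1 cS)
  have trace: "mat_trace G = real n * real p"
    using G lS by (simp add: mat_trace_def entry r1)
  have trace2: "mat_trace (G ^\<^sub>m 2) = (real n * real p)\<^sup>2 * h p (s\<^sup>2)"
  proof -
    \<comment> \<open>Symmetry turns the trace of the square into the sum of all squared
      entries.\<close>
    have "G ^\<^sub>m 2 = G\<^sup>T * G" using G sym by (simp add: numeral_2_eq_2)
    then have "mat_trace (G ^\<^sub>m 2) = (\<Sum>b<p. \<Sum>a<p. (G $$ (a, b))\<^sup>2)"
      using mat_trace_transpose_mult[OF G] by simp
    also have "\<dots> = (\<Sum>b<p. \<Sum>a<p. (real n)\<^sup>2 * (r (l ! a) (l ! b))\<^sup>2)"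
      by (intro sum.cong refl) (simp add: entry power_mult_distrib)
    also have "\<dots> = (real n)\<^sup>2 * (\<Sum>a<p. \<Sum>b<p. (r (l ! a) (l ! b))\<^sup>2)"
      by (subst sum.swap) (simp add: sum_distrib_left)
    finally show ?thesis using reindex[of "\<lambda>i j. (r i j)\<^sup>2"] sum_r2
      by (simp add: power_mult_distrib)
  qed
  have p1: "p \<ge> 1" using p by simp
  define L where "L = lambda_max G"
  obtain es where es: "length es = p" "\<And>e. e \<in> set es \<Longrightarrow> 0 \<le> e" "spectrum G = set es"
    "char_poly G = (\<Prod>e\<leftarrow>es. [:- e, 1:])" "L \<in> set es" "\<And>e. e \<in> set es \<Longrightarrow> e \<le> L"
    using spectrum_Gram_matrix[OF x p1, folded G_def, folded L_def] by blast
  have evL: "eigenvalue G L" using es(3,5) unfolding spectrum_def by auto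
  have \<phi>: "\<phi> = L / (real n * real p)"
    unfolding assms(6) pc1_proportion_def x_def[symmetric] G_def[symmetric] L_def[symmetric] trace ..
  \<comment> \<open>Indexing by list position counts a repeated eigenvalue as often as it occurs, as
    the trace formulas require.\<close>
  define \<mu> where "\<mu> a = es ! a / (real n * real p)" for a
  obtain m where m: "m < p" "es ! m = L" using es(1,5) by (metis in_set_conv_nth)
  have \<mu>m: "\<mu> m = \<phi>" unfolding \<mu>_def \<phi> m ..
  have sum_es: "(\<Sum>e\<leftarrow>es. e ^ k) = (\<Sum>a<p. (es ! a) ^ k)" for k
    using es(1) by (simp add: sum_list_sum_nth lessThan_atLeast0)
  have "(\<Sum>a<p. es ! a) = real n * real p"
    using mat_trace_pow_eigenvalues[OF G es(4), of 1] sum_es[of 1] trace G by simp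
  then have sum\<mu>: "(\<Sum>a<p. \<mu> a) = 1"
    unfolding \<mu>_def sum_divide_distrib[symmetric] using np by simp
  have "(\<Sum>a<p. (es ! a)\<^sup>2) = (real n * real p)\<^sup>2 * h p (s\<^sup>2)"
    using mat_trace_pow_eigenvalues[OF G es(4), of 2] sum_es[of 2] trace2 by simp
  then have sum\<mu>2: "(\<Sum>a<p. (\<mu> a)\<^sup>2) = h p (s\<^sup>2)"
    unfolding \<mu>_def power_divide sum_divide_distrib[symmetric] using np by simp
  have lower_star: "h_star (h p (s\<^sup>2)) \<le> \<phi>"
    unfolding sum\<mu>2[symmetric] \<mu>m[symmetric]
    using m es sum\<mu> np
    by (intro h_star_le_largest_share) (auto simp: \<mu>_def divide_right_mono)
  have upper_s: "\<phi> \<le> h p s"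
    unfolding \<mu>m[symmetric]
    by (rule share_le_h[of "{..<p}" m]) (use m p assms(8) sum\<mu> sum\<mu>2 in auto)
  have lower_\<rho>: "h p \<rho> \<le> \<phi>"
  proof -
    define v :: "real vec" where "v = vec p (\<lambda>_. 1)"
    have "v \<bullet> (G *\<^sub>v v) = (\<Sum>a<p. \<Sum>b<p. G $$ (a, b))"
      using G by (simp add: v_def scalar_prod_def lessThan_atLeast0)
    also have "\<dots> = real n * (\<Sum>a<p. \<Sum>b<p. r (l ! a) (l ! b))"
      by (simp add: entry sum_distrib_left)
    also have "\<dots> = real n * ((real p)\<^sup>2 * h p \<rho>)" using reindex[of r] sum_r by simp
    \<comment> \<open>The Rayleigh bound asks for \<open>\<bar>e\<bar> \<le> L\<close>; for the
      nonnegative eigenvalues of a Gram matrix this is just \<open>e \<le> L\<close>.\<close>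
    finally have "real n * ((real p)\<^sup>2 * h p \<rho>) \<le> L * (v \<bullet> v)"
      using Rayleigh_quotient_le[OF G sym es(4), of L v] es(2,5,6) by (simp add: v_def)
    also have "v \<bullet> v = real p" by (simp add: v_def scalar_prod_def)
    finally show ?thesis using np unfolding \<phi> by (simp add: field_simps power2_eq_square)
  qed
  have upper_row: "\<phi> \<le> Max ((\<lambda>i. h p (row_mean_abs_corr X S i)) ` S)"
  proof -
    obtain a where a: "a < p" "L \<le> G $$ (a, a) + (\<Sum>b\<in>{..<p} - {a}. \<bar>G $$ (a, b)\<bar>)"
      using Gershgorin_upper_bound[OF G evL] by blast
    let ?i = "l ! a"
    have "bij_betw ((!) l) ({..<p} - {a}) (S - {?i})"
      using l a(1) by (auto simp: bij_betw_def inj_on_def)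
    then have "(\<Sum>b\<in>{..<p} - {a}. \<bar>r ?i (l ! b)\<bar>) = (\<Sum>j\<in>S - {?i}. \<bar>r ?i j\<bar>)"
      by (rule sum.reindex_bij_betw)
    moreover have "(\<Sum>b\<in>{..<p} - {a}. \<bar>G $$ (a, b)\<bar>) = real n * (\<Sum>b\<in>{..<p} - {a}. \<bar>r ?i (l ! b)\<bar>)"
      unfolding sum_distrib_left using a(1) by (intro sum.cong) (auto simp: entry abs_mult)
    moreover have "(\<Sum>j\<in>S - {?i}. \<bar>r ?i j\<bar>) = (real p - 1) * row_mean_abs_corr X S ?i"
      unfolding row_mean_abs_corr_def cS r_def using np by simp
    ultimately have row: "(\<Sum>b\<in>{..<p} - {a}. \<bar>G $$ (a, b)\<bar>)
        = real n * ((real p - 1) * row_mean_abs_corr X S ?i)"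
      by (simp only:)
    have "G $$ (a, a) = real n" using a(1) lS by (simp add: entry r1)
    with a(2) row have "L \<le> real n * (1 + (real p - 1) * row_mean_abs_corr X S ?i)"
      by (simp add: distrib_left)
    then have "\<phi> \<le> h p (row_mean_abs_corr X S ?i)"
      using np unfolding \<phi> h_def by (simp add: field_simps)
    also have "\<dots> \<le> Max ((\<lambda>i. h p (row_mean_abs_corr X S i)) ` S)"
      using S lS[OF a(1)] by (intro Max_ge) auto
    finally show ?thesis .
  qed
  have equal: "\<phi> = (if \<rho> \<ge> 0 then h p \<rho> else (1 - \<rho>) / real p)"
    if c: "\<forall>i\<in>S. \<forall>j\<in>S. i \<noteq> j \<longrightarrow> sample_corr (X i) (X j) = c" for c
  proof -
    have rc: "r i j = (if i = j then 1 else c)" if "i \<in> S" "j \<in> S" for i j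
      using c r1 that unfolding r_def by auto
    have inj: "l ! a = l ! b \<longleftrightarrow> a = b" if "a < p" "b < p" for a b
      using l that by (auto simp: bij_betw_def inj_on_def)
    have eG: "G $$ (a, b) = (if a = b then real n else real n * c)" if "a < p" "b < p" for a b
      using that lS by (simp add: entry rc inj)
    \<comment> \<open>Evaluating the sum of all correlations once through \<open>\<rho>\<close> and
      once through \<open>c\<close> identifies the two.\<close>
    have "(real p)\<^sup>2 * h p \<rho> = (\<Sum>i\<in>S. \<Sum>j\<in>S. (if j = i then 1 - c else 0) + c)"
      unfolding sum_r[symmetric] by (intro sum.cong refl) (simp add: rc)
    also have "\<dots> = real p * (1 - c + real p * c)"
      using S cS by (simp add: sum.distrib)
    finally have "(real p)\<^sup>2 * h p \<rho> = real p * (1 - c + real p * c)" .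
    moreover have "(real p)\<^sup>2 * h p \<rho> = real p * (1 + (real p - 1) * \<rho>)"
      using np by (simp add: h_def field_simps power2_eq_square)
    ultimately have "real p * (real p - 1) * (\<rho> - c) = 0" by (simp add: algebra_simps)
    then have \<rho>: "\<rho> = c" using np by simp
    have "L = real n - real n * c \<or> L = real n + (real p - 1) * (real n * c)"
      by (rule eigenvalue_equicorrelation_cases[OF G eG evL])
    then have cases: "\<phi> = (1 - c) / real p \<or> \<phi> = h p c"
      unfolding \<phi> h_def using np by (auto simp: field_simps)
    have "eigenvalue G (real n - real n * c)"
      by (rule eigenvalue_equicorrelation[OF G p(2) eG])
    then have "real n - real n * c \<le> L" using es(3,6) unfolding spectrum_def by auto
    then have "(real n - real n * c) / (real n * real p) \<le> \<phi>"
      unfolding \<phi> using np by (intro divide_right_mono) auto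
    moreover have "(real n - real n * c) / (real n * real p) = (1 - c) / real p"
      using np by (simp add: field_simps)
    ultimately have "(1 - c) / real p \<le> \<phi>" by (simp only:)
    \<comment> \<open>Both candidate values are at most \<open>\<phi>\<close> and
      \<open>\<phi>\<close> is one of them, hence their maximum; the sign of their difference
      \<open>c\<close> decides which.\<close>
    moreover have "h p c - (1 - c) / real p = c"
      unfolding h_def using np by (simp add: field_simps)
    ultimately show ?thesis using cases lower_\<rho> unfolding \<rho> by (cases "c \<ge> 0") auto
  qed
  show ?thesis
  proof (intro conjI impI)
    show "max (h p \<rho>) (h_star (h p (s\<^sup>2))) \<le> \<phi>" using lower_\<rho> lower_star by simp
    show "\<phi> \<le> min (h p s) (Max ((\<lambda>i. h p (row_mean_abs_corr X S i)) ` S))"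
      using upper_s upper_row by simp
  next
    assume "\<exists>c. \<forall>i\<in>S. \<forall>j\<in>S. i \<noteq> j \<longrightarrow> sample_corr (X i) (X j) = c"
    then show "\<phi> = (if \<rho> \<ge> 0 then h p \<rho> else (1 - \<rho>) / real p)" using equal by blast
  qed
qed

end
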